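(* Let $X$ be a separable infinite-dimensional real Hilbert space and let $Q:X\to X$ be a symmetric positive trace class operator. Let $\{e_k\}_{k\in\mathbb{N}}$ be a complete orthonormal basis of $X$ and $\{\lambda_k\}_{k\in\mathbb{N}}$ a sequence of non-negative numbers such that $Qe_k=\lambda_k e_k$ for all $k$ and $\sum_{k=1}^\infty\lambda_k<\infty$. Let $\Phi:X\to\mathbb{R}$ be locally Lipschitz continuous in the following sense: for every $r>0$ there exists a constant $L_r>0$ such that for all $z_1,z_2\in X$ with $z_1\neq z_2$ and $\|z_1\|_X,\|z_2\|_X<r$, $$|\Phi(z_1)-\Phi(z_2)|<L_r\|z_1-z_2\|_X.$$ Define $J:X\to\mathbb{R}$ by $J(x)=\Phi(Q^{1/2}x)+\|x\|_X^2$. Then there exists a constant $L>0$ such that, for any $x\in\arg\min_{x\in X}J(x)$ and any $n\in\mathbb{N}$, $$\|x-x_n\|_X<L\sqrt{\lambda_n^*},$$ where $x_n=\sum_{k=1}^n\langle x,e_k\rangle_X\,e_k$ and $\lambda_n^*=\max_{k>n}\lambda_k$.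
   Context: $X$ carries the inner product $\langle\cdot,\cdot\rangle_X$ and norm $\|\cdot\|_X$; $\mathbb{N}=\{1,2,\dots\}$. The operator $Q$ is the covariance operator of a zero-mean Gaussian prior measure on $X$; it is bounded, self-adjoint, of trace class, and positive in the sense that $\langle Qx,x\rangle_X>0$ for all $x\neq0$. The function $\Phi$ is the negative log-likelihood of a Bayesian inverse problem. The set $\arg\min_{x\in X}J(x)$ is the set of global minimizers of $J$ over $X$.
   Formalization: The constant L is uniform on each bounded set of minimizers of J (all of them if argmin J is bounded, e.g. Φ bounded below), not on all of argmin J: Φ may be unbounded below, argmin J may then be unbounded, and the claim with a single L for all minimizers fails. *)

theory Defs
  imports "HOL-Analysis.Analysis"
begin

text \<open>A separable real Hilbert space is a type of sort
  \<open>{real_inner, polish_space}\<close> (complete and second countable). Sequences indexed by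
  \<open>{1, 2, \<dots>}\<close> are functions on \<^typ>\<open>nat\<close> whose value at \<open>0\<close> is never used.\<close>

definition infinite_dimensional :: "'a::real_vector itself \<Rightarrow> bool" where
  "infinite_dimensional _ \<longleftrightarrow> \<not> (\<exists>B :: 'a set. finite B \<and> span B = UNIV)"

definition symmetric_op :: "('a::real_inner \<Rightarrow> 'a) \<Rightarrow> bool" where
  "symmetric_op T \<longleftrightarrow> (\<forall>x y. T x \<bullet> y = x \<bullet> T y)"

definition positive_op :: "('a::real_inner \<Rightarrow> 'a) \<Rightarrow> bool" where
  "positive_op T \<longleftrightarrow> (\<forall>x. x \<noteq> 0 \<longrightarrow> T x \<bullet> x > 0)"

text \<open>Trace class (= nuclear) operators on a Hilbert space, as usual for covariance operators
  of Gaussian measures: \<open>T x = \<Sum>k. \<langle>x, a k\<rangle> b k\<close> with \<open>\<Sum>k. \<parallel>a k\<parallel> \<parallel>b k\<parallel> < \<infinity>\<close>.\<close>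

definition trace_class :: "('a::real_inner \<Rightarrow> 'a) \<Rightarrow> bool" where
  "trace_class T \<longleftrightarrow> bounded_linear T \<and>
     (\<exists>a b. summable (\<lambda>k::nat. norm (a k) * norm (b k)) \<and>
            (\<forall>x. (\<lambda>k. (x \<bullet> a k) *\<^sub>R b k) sums T x))"

text \<open>The nonnegative self-adjoint square root, which is unique whenever it exists.\<close>

definition sqrt_op :: "('a::real_inner \<Rightarrow> 'a) \<Rightarrow> 'a \<Rightarrow> 'a" where
  "sqrt_op T = (THE S. bounded_linear S \<and> symmetric_op S \<and> (\<forall>x. S x \<bullet> x \<ge> 0) \<and> S \<circ> S = T)"

definition complete_orthonormal_basis :: "(nat \<Rightarrow> 'a::real_inner) \<Rightarrow> bool" where
  "complete_orthonormal_basis e \<longleftrightarrow>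
     (\<forall>j\<ge>1. \<forall>k\<ge>1. e j \<bullet> e k = (if j = k then 1 else 0)) \<and>
     closure (span (e ` {1..})) = UNIV"

definition locally_lipschitz :: "('a::real_normed_vector \<Rightarrow> real) \<Rightarrow> bool" where
  "locally_lipschitz \<Phi> \<longleftrightarrow>
     (\<forall>r>0. \<exists>L>0. \<forall>z1 z2. z1 \<noteq> z2 \<longrightarrow> norm z1 < r \<longrightarrow> norm z2 < r \<longrightarrow>
        \<bar>\<Phi> z1 - \<Phi> z2\<bar> < L * norm (z1 - z2))"

definition objective :: "('a::real_inner \<Rightarrow> 'a) \<Rightarrow> ('a \<Rightarrow> real) \<Rightarrow> 'a \<Rightarrow> real" where
  "objective Q \<Phi> x = \<Phi> (sqrt_op Q x) + (norm x)\<^sup>2"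

definition argmin_set :: "('a \<Rightarrow> real) \<Rightarrow> 'a set" where
  "argmin_set J = {x. is_arg_min J (\<lambda>_. True) x}"

definition proj_trunc :: "(nat \<Rightarrow> 'a::real_inner) \<Rightarrow> nat \<Rightarrow> 'a \<Rightarrow> 'a" where
  "proj_trunc e n x = (\<Sum>k=1..n. (x \<bullet> e k) *\<^sub>R e k)"

text \<open>The maximum of the infinite set \<open>{l k | k > n}\<close>; \<^const>\<open>Max\<close> only covers finite sets.\<close>

definition lambda_star :: "(nat \<Rightarrow> real) \<Rightarrow> nat \<Rightarrow> real" where
  "lambda_star l n = (GREATEST m. m \<in> l ` {n<..})"

text \<open>Pitfall: minimizers of \<open>objective Q \<Phi>\<close> need not form a bounded set, as \<open>\<Phi>\<close> need not be
  bounded below, and then no estimate \<open>\<parallel>x - x_n\<parallel> < L sqrt (lambda_star l n)\<close> holds with one \<open>L\<close> for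
  all of them. For \<open>\<Phi> y = (1 - 1 / l 1) \<langle>y, e 1\<rangle>^2 - 2 \<langle>y, e 1\<rangle> \<langle>y, e 2\<rangle> / sqrt (l 2)\<close>, which is
  locally Lipschitz, and \<open>x_k = \<langle>x, e k\<rangle>\<close>, the objective is
  \<open>(x_2 - sqrt (l 1) x_1)^2 + (\<Sum>k\<ge>3. x_k^2)\<close>; every \<open>t (e 1 + sqrt (l 1) e 2)\<close> is a minimizer,
  and its distance to its first truncation is \<open>\<bar>t\<bar> sqrt (l 1)\<close>. The constant is therefore
  taken uniform on bounded sets of minimizers, which is uniform on all of \<open>argmin_set\<close> as soon as
  that set is bounded (for instance if \<open>\<Phi>\<close> is bounded below).\<close>

end

theory Submission
  imports Defs
begin

text \<open>
  The argument compares a minimizer \<open>x\<close> with its own truncation \<open>x_n\<close>. Put \<open>y = x - x_n\<close> and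
  \<open>S = Q\<^sup>1\<^sup>/\<^sup>2\<close>. Since \<open>y\<close> is orthogonal to \<open>x_n\<close>, minimality \<open>J x \<le> J x_n\<close> becomes
  \<open>\<parallel>y\<parallel>\<^sup>2 \<le> \<Phi> (S x_n) - \<Phi> (S x)\<close>, and the Lipschitz condition bounds the right-hand side by
  \<open>L \<parallel>S y\<parallel>\<close>. As \<open>y\<close> only has components along \<open>e k\<close> with \<open>k > n\<close>, the operator \<open>S\<close> shrinks it by
  at least the factor \<open>sqrt (lambda_star l n)\<close> (\<open>norm_diag_tail_le\<close>). Dividing by \<open>\<parallel>y\<parallel>\<close> gives the
  estimate. The constant \<open>L\<close> belongs to a ball containing \<open>S x\<close> and \<open>S x_n\<close>, which can be chosen
  for a whole bounded set of minimizers because \<open>\<parallel>x_n\<parallel> \<le> \<parallel>x\<parallel>\<close>. The inequality stays strict when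
  \<open>y = 0\<close> because positivity of \<open>Q\<close> makes all eigenvalues positive (\<open>lambda_star_pos\<close>).

  What needs work is that \<open>S\<close>, given by a definite description, is the diagonal operator
  \<open>x \<mapsto> \<Sum>k. sqrt (l k) \<langle>x, e k\<rangle> e k\<close>. The series converges because
  \<open>\<Sum>k. l k \<langle>x, e k\<rangle>\<^sup>2 \<le> \<parallel>x\<parallel>\<^sup>2 \<Sum>k. l k\<close>, and it defines a symmetric nonnegative square root of \<open>Q\<close>
  (\<open>diagonal_sqrt\<close>). It is the only one since any bounded, symmetric and nonnegative square root of \<open>Q\<close> has each \<open>e k\<close>
  as an eigenvector with eigenvalue \<open>sqrt (l k)\<close> (\<open>sqrt_eigenvector\<close>).
\<close>

section \<open>Orthonormal sequences\<close>

lemma basis_inner: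
  assumes "complete_orthonormal_basis e" "j \<ge> 1" "k \<ge> 1"
  shows "e j \<bullet> e k = (if j = k then 1 else 0)"
  using assms unfolding complete_orthonormal_basis_def by blast

lemma norm_basis_sum:
  assumes "complete_orthonormal_basis e" "finite A" "A \<subseteq> {1..}"
  shows "(norm (\<Sum>k\<in>A. c k *\<^sub>R e k))\<^sup>2 = (\<Sum>k\<in>A. (c k)\<^sup>2)"
proof -
  have "(norm (\<Sum>k\<in>A. c k *\<^sub>R e k))\<^sup>2 = (\<Sum>j\<in>A. \<Sum>k\<in>A. c j * (c k * (e j \<bullet> e k)))"
    by (simp add: power2_norm_eq_inner inner_sum_left inner_sum_right sum_distrib_left inner_commute
        mult.left_commute)
  also have "\<dots> = (\<Sum>j\<in>A. \<Sum>k\<in>A. if j = k then (c j)\<^sup>2 else 0)"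
    using assms(3) by (intro sum.cong refl) (auto simp: basis_inner[OF assms(1)] power2_eq_square subset_iff)
  also have "\<dots> = (\<Sum>k\<in>A. (c k)\<^sup>2)"
    using assms(2) by simp
  finally show ?thesis .
qed

lemma norm_basis:
  assumes "complete_orthonormal_basis e" "k \<ge> 1"
  shows "norm (e k) = 1"
  using basis_inner[OF assms(1) assms(2) assms(2)] by (simp add: norm_eq_1)

lemma norm_proj_trunc:
  assumes "complete_orthonormal_basis e"
  shows "(norm (proj_trunc e n x))\<^sup>2 = (\<Sum>k=1..n. (x \<bullet> e k)\<^sup>2)"
  unfolding proj_trunc_def by (rule norm_basis_sum[OF assms]) auto

lemma inner_proj_trunc_basis:
  assumes "complete_orthonormal_basis e" "1 \<le> k" "k \<le> n"
  shows "proj_trunc e n x \<bullet> e k = x \<bullet> e k"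
proof -
  have "proj_trunc e n x \<bullet> e k = (\<Sum>j=1..n. if j = k then x \<bullet> e j else 0)"
    unfolding proj_trunc_def inner_sum_left
    using assms(2) by (intro sum.cong refl) (auto simp: basis_inner[OF assms(1)])
  then show ?thesis
    using assms(2,3) by simp
qed

lemma proj_trunc_Pythagorean:
  assumes "complete_orthonormal_basis e"
  shows "(norm x)\<^sup>2 = (norm (proj_trunc e n x))\<^sup>2 + (norm (x - proj_trunc e n x))\<^sup>2"
proof -
  have "proj_trunc e n x \<bullet> (x - proj_trunc e n x)
      = (\<Sum>k=1..n. (x \<bullet> e k) * ((x - proj_trunc e n x) \<bullet> e k))"
    by (subst (1) proj_trunc_def) (simp add: inner_sum_left inner_commute[of "e _"])
  also have "\<dots> = 0"
    by (intro sum.neutral) (simp add: inner_diff_left inner_proj_trunc_basis[OF assms])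
  finally have "(norm (proj_trunc e n x + (x - proj_trunc e n x)))\<^sup>2
      = (norm (proj_trunc e n x))\<^sup>2 + (norm (x - proj_trunc e n x))\<^sup>2"
    by (intro norm_add_Pythagorean) (simp add: orthogonal_def)
  then show ?thesis
    by simp
qed

lemma norm_proj_trunc_le:
  assumes "complete_orthonormal_basis e"
  shows "norm (proj_trunc e n x) \<le> norm x"
  by (rule power2_le_imp_le) (simp_all add: proj_trunc_Pythagorean[OF assms, of x n])

lemma bounded_linear_eq_on_basis:
  assumes "complete_orthonormal_basis e" "bounded_linear S" "bounded_linear T"
    and "\<And>k. k \<ge> 1 \<Longrightarrow> S (e k) = T (e k)"
  shows "S = T"
proof
  fix x
  have lin: "linear S" "linear T"
    using assms(2,3) by (simp_all add: bounded_linear.linear)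
  have "S z = T z" if "z \<in> span (e ` {1..})" for z
    using linear_eq_on_span[OF lin _ that] assms(4) by auto
  moreover have "x \<in> closure (span (e ` {1..}))"
    using assms(1) unfolding complete_orthonormal_basis_def by simp
  moreover have "closed {z. S z = T z}"
    by (intro closed_Collect_eq linear_continuous_on assms(2,3))
  ultimately show "S x = T x"
    using closure_minimal[of "span (e ` {1..})" "{z. S z = T z}"] by blast
qed

section \<open>The square root of a diagonal operator\<close>

definition diag_trunc :: "(nat \<Rightarrow> real) \<Rightarrow> (nat \<Rightarrow> 'a::real_inner) \<Rightarrow> nat \<Rightarrow> 'a \<Rightarrow> 'a" where
  "diag_trunc c e N x = (\<Sum>k=1..N. (c k * (x \<bullet> e k)) *\<^sub>R e k)"

lemma linear_diag_trunc: "linear (diag_trunc c e N)"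
  unfolding diag_trunc_def
  by (intro linearI)
     (simp_all add: inner_add_left algebra_simps sum.distrib scaleR_sum_right)

lemma diag_trunc_symmetric: "diag_trunc c e N x \<bullet> y = x \<bullet> diag_trunc c e N y"
  unfolding diag_trunc_def inner_sum_left inner_sum_right
  by (intro sum.cong refl) (simp add: inner_commute)

lemma diag_trunc_nonneg:
  assumes "\<And>k. k \<ge> 1 \<Longrightarrow> c k \<ge> 0"
  shows "diag_trunc c e N x \<bullet> x \<ge> 0"
  unfolding diag_trunc_def inner_sum_left
  by (intro sum_nonneg) (simp add: inner_commute mult.assoc assms)

lemma diag_trunc_basis:
  assumes "complete_orthonormal_basis e" "1 \<le> k" "k \<le> N"
  shows "diag_trunc c e N (e k) = c k *\<^sub>R e k"
proof -
  have "diag_trunc c e N (e k) = (\<Sum>j=1..N. if j = k then c j *\<^sub>R e j else 0)"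
    unfolding diag_trunc_def
    using assms(2) by (intro sum.cong refl) (auto simp: basis_inner[OF assms(1)])
  then show ?thesis
    using assms(2,3) by simp
qed

text \<open>Square summability of the coefficients suffices for norm convergence because the components
  \<open>\<langle>x, e k\<rangle>\<close> are bounded by \<open>\<parallel>x\<parallel>\<close>; the differences of partial sums are thereby controlled by
  those of \<open>\<Sum>k. (c k)\<^sup>2\<close>.\<close>

lemma norm_diag_trunc_diff_le:
  assumes "complete_orthonormal_basis e" "M \<le> N"
  shows "(norm (diag_trunc c e N x - diag_trunc c e M x))\<^sup>2
         \<le> (norm x)\<^sup>2 * ((\<Sum>k=1..N. (c k)\<^sup>2) - (\<Sum>k=1..M. (c k)\<^sup>2))"
proof -
  have split: "sum f {1..N} - sum f {1..M} = sum f {M<..N}" for f :: "nat \<Rightarrow> 'b::ab_group_add"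
  proof -
    have "{1..N} = {1..M} \<union> {M<..N}"
      using assms(2) by auto
    then have "sum f {1..N} = sum f {1..M} + sum f {M<..N}"
      by (simp only:) (intro sum.union_disjoint; auto)
    then show ?thesis by simp
  qed
  have "(norm (diag_trunc c e N x - diag_trunc c e M x))\<^sup>2 = (\<Sum>k\<in>{M<..N}. (c k * (x \<bullet> e k))\<^sup>2)"
    unfolding diag_trunc_def split by (rule norm_basis_sum[OF assms(1)]) auto
  also have "\<dots> \<le> (\<Sum>k\<in>{M<..N}. (norm x)\<^sup>2 * (c k)\<^sup>2)"
  proof (intro sum_mono)
    fix k assume "k \<in> {M<..N}"
    then have "\<bar>x \<bullet> e k\<bar> \<le> norm x"
      using Cauchy_Schwarz_ineq2[of x "e k"] norm_basis[OF assms(1), of k] by simp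
    then have "(x \<bullet> e k)\<^sup>2 \<le> (norm x)\<^sup>2"
      by (metis abs_ge_zero power2_abs power_mono)
    then show "(c k * (x \<bullet> e k))\<^sup>2 \<le> (norm x)\<^sup>2 * (c k)\<^sup>2"
      by (simp add: power_mult_distrib mult_left_mono mult.commute[of "(norm x)\<^sup>2"])
  qed
  also have "\<dots> = (norm x)\<^sup>2 * ((\<Sum>k=1..N. (c k)\<^sup>2) - (\<Sum>k=1..M. (c k)\<^sup>2))"
    unfolding split by (simp add: sum_distrib_left)
  finally show ?thesis .
qed

lemma convergent_diag_trunc:
  fixes e :: "nat \<Rightarrow> 'a::{real_inner, complete_space}"
  assumes "complete_orthonormal_basis e" "convergent (\<lambda>N. \<Sum>k=1..N. (c k)\<^sup>2)"
  shows "convergent (\<lambda>N. diag_trunc c e N x)"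
proof -
  let ?s = "\<lambda>N. \<Sum>k=1..N. (c k)\<^sup>2"
  have le: "(norm (diag_trunc c e N x - diag_trunc c e M x))\<^sup>2 \<le> (norm x)\<^sup>2 * \<bar>?s N - ?s M\<bar>" for M N
  proof (cases "M \<le> N")
    case True
    show ?thesis
      by (rule order_trans[OF norm_diag_trunc_diff_le[OF assms(1) True]]) (intro mult_left_mono; simp)
  next
    case False
    then have "N \<le> M" by simp
    from norm_diag_trunc_diff_le[OF assms(1) this, of c x]
    have "(norm (diag_trunc c e N x - diag_trunc c e M x))\<^sup>2 \<le> (norm x)\<^sup>2 * (?s M - ?s N)"
      by (simp add: norm_minus_commute)
    also have "\<dots> \<le> (norm x)\<^sup>2 * \<bar>?s N - ?s M\<bar>"
      by (intro mult_left_mono) auto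
    finally show ?thesis .
  qed
  have "Cauchy (\<lambda>N. diag_trunc c e N x)"
  proof (rule CauchyI)
    fix \<epsilon> :: real assume \<epsilon>: "\<epsilon> > 0"
    have pos: "(norm x)\<^sup>2 + 1 > 0"
      by (simp add: add_nonneg_pos)
    have "Cauchy ?s"
      by (rule convergent_Cauchy[OF assms(2)])
    moreover have "\<epsilon>\<^sup>2 / ((norm x)\<^sup>2 + 1) > 0"
      using \<epsilon> pos by simp
    ultimately obtain K where
      K: "\<And>m n. m \<ge> K \<Longrightarrow> n \<ge> K \<Longrightarrow> \<bar>?s m - ?s n\<bar> < \<epsilon>\<^sup>2 / ((norm x)\<^sup>2 + 1)"
      by (metis CauchyD real_norm_def)
    have "norm (diag_trunc c e m x - diag_trunc c e n x) < \<epsilon>" if "m \<ge> K" "n \<ge> K" for m n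
    proof -
      have "(norm x)\<^sup>2 * \<bar>?s m - ?s n\<bar> \<le> ((norm x)\<^sup>2 + 1) * \<bar>?s m - ?s n\<bar>"
        by (intro mult_right_mono) auto
      also have "\<dots> < \<epsilon>\<^sup>2"
        using K[OF that] pos by (simp add: field_simps)
      finally have "(norm (diag_trunc c e m x - diag_trunc c e n x))\<^sup>2 < \<epsilon>\<^sup>2"
        using le[of m n] by linarith
      then show ?thesis
        by (rule power2_less_imp_less) (use \<epsilon> in simp)
    qed
    then show "\<exists>K. \<forall>m\<ge>K. \<forall>n\<ge>K. norm (diag_trunc c e m x - diag_trunc c e n x) < \<epsilon>"
      by blast
  qed
  then show ?thesis
    by (rule Cauchy_convergent)
qed

lemma diagonal_sqrt:
  fixes e :: "nat \<Rightarrow> 'a::{real_inner, complete_space}"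
  assumes e: "complete_orthonormal_basis e" and Q: "bounded_linear Q"
    and l: "\<And>k. k \<ge> 1 \<Longrightarrow> l k \<ge> 0" and eig: "\<And>k. k \<ge> 1 \<Longrightarrow> Q (e k) = l k *\<^sub>R e k"
    and sm: "summable (\<lambda>k. l (Suc k))"
  obtains S where "bounded_linear S" "symmetric_op S" "\<And>x. S x \<bullet> x \<ge> 0" "S \<circ> S = Q"
    "\<And>x. (\<lambda>N. diag_trunc (\<lambda>k. sqrt (l k)) e N x) \<longlonglongrightarrow> S x"
proof -
  define T where "T = diag_trunc (\<lambda>k. sqrt (l k)) e"
  define S where "S = (\<lambda>x. lim (\<lambda>N. T N x))"
  have sq: "(\<Sum>k=1..N. (sqrt (l k))\<^sup>2) = (\<Sum>k<N. l (Suc k))" for N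
  proof -
    have "(\<Sum>k=1..N. (sqrt (l k))\<^sup>2) = (\<Sum>k=Suc 0..N. l k)"
      by (intro sum.cong) (auto simp: l)
    also have "\<dots> = (\<Sum>k<N. l (Suc k))"
      by (rule sum.atLeast1_atMost_eq)
    finally show ?thesis .
  qed
  have "convergent (\<lambda>N. \<Sum>k=1..N. (sqrt (l k))\<^sup>2)"
    using sm unfolding sq by (simp add: summable_iff_convergent)
  then have lim: "(\<lambda>N. T N x) \<longlonglongrightarrow> S x" for x
    unfolding S_def T_def using convergent_diag_trunc[OF e] by (simp only: convergent_LIMSEQ_iff)
  have lin: "linear (T N)" for N
    unfolding T_def by (rule linear_diag_trunc)
  have bound: "norm (S x) \<le> norm x * sqrt (\<Sum>k. l (Suc k))" for x
  proof (rule LIMSEQ_le_const2[OF tendsto_norm[OF lim]], intro exI allI impI)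
    fix N
    have "(norm (T N x))\<^sup>2 \<le> (norm x)\<^sup>2 * (\<Sum>k<N. l (Suc k))"
      using norm_diag_trunc_diff_le[OF e le0, of "\<lambda>k. sqrt (l k)" N x]
      unfolding sq by (simp add: T_def diag_trunc_def)
    also have "\<dots> \<le> (norm x)\<^sup>2 * (\<Sum>k. l (Suc k))"
      by (intro mult_left_mono sum_le_suminf sm) (auto simp: l)
    finally have "sqrt ((norm (T N x))\<^sup>2) \<le> sqrt ((norm x)\<^sup>2 * (\<Sum>k. l (Suc k)))"
      by (rule real_sqrt_le_mono)
    then show "norm (T N x) \<le> norm x * sqrt (\<Sum>k. l (Suc k))"
      by (simp add: real_sqrt_mult)
  qed
  have bl: "bounded_linear S"
  proof (rule bounded_linear_intro[OF _ _ bound])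
    show "S (x + y) = S x + S y" for x y
      by (rule LIMSEQ_unique[OF lim]) (simp add: linear_add[OF lin] tendsto_add[OF lim lim])
    show "S (r *\<^sub>R x) = r *\<^sub>R S x" for r x
      by (rule LIMSEQ_unique[OF lim]) (simp add: linear_scale[OF lin] tendsto_scaleR[OF tendsto_const lim])
  qed
  have "S x \<bullet> y = x \<bullet> S y" for x y
  proof (rule LIMSEQ_unique[OF tendsto_inner[OF lim tendsto_const]])
    show "(\<lambda>N. T N x \<bullet> y) \<longlonglongrightarrow> x \<bullet> S y"
      using tendsto_inner[OF tendsto_const lim] by (simp add: T_def diag_trunc_symmetric)
  qed
  then have sym: "symmetric_op S"
    by (simp add: symmetric_op_def)
  have nonneg: "S x \<bullet> x \<ge> 0" for x
    by (rule LIMSEQ_le_const[OF tendsto_inner[OF lim tendsto_const]])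
       (use l in \<open>auto simp: T_def intro!: exI diag_trunc_nonneg\<close>)
  have Se: "S (e k) = sqrt (l k) *\<^sub>R e k" if "k \<ge> 1" for k
  proof (rule LIMSEQ_unique[OF lim])
    have "\<forall>\<^sub>F N in sequentially. T N (e k) = sqrt (l k) *\<^sub>R e k"
      unfolding T_def using diag_trunc_basis[OF e that] eventually_sequentially by blast
    then show "(\<lambda>N. T N (e k)) \<longlonglongrightarrow> sqrt (l k) *\<^sub>R e k"
      by (rule tendsto_eventually)
  qed
  have "S \<circ> S = Q"
  proof (rule bounded_linear_eq_on_basis[OF e _ Q])
    show "bounded_linear (S \<circ> S)"
      unfolding comp_def by (rule bounded_linear_compose[OF bl bl])
    show "(S \<circ> S) (e k) = Q (e k)" if "k \<ge> 1" for k
      using that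
      by (simp add: Se eig l linear_scale[OF bounded_linear.linear[OF bl]] flip: real_sqrt_mult)
  qed
  then show thesis
    using that[OF bl sym nonneg] lim unfolding T_def by blast
qed

text \<open>The vector \<open>w = S v - sqrt r v\<close> satisfies \<open>S w = - sqrt r w\<close>, which a nonnegative \<open>S\<close>
  only allows for \<open>w = 0\<close> when \<open>r > 0\<close>. For \<open>r = 0\<close>, symmetry gives
  \<open>\<parallel>S v\<parallel>\<^sup>2 = \<langle>S (S v), v\<rangle> = 0\<close>.\<close>

lemma sqrt_eigenvector:
  assumes lin: "linear S" and sym: "symmetric_op S" and nonneg: "\<And>x. S x \<bullet> x \<ge> 0"
    and eig: "S (S v) = r *\<^sub>R v" and r: "r \<ge> 0"
  shows "S v = sqrt r *\<^sub>R v"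
proof (cases "r = 0")
  case True
  have "S v \<bullet> S v = S (S v) \<bullet> v"
    using sym unfolding symmetric_op_def by simp
  with True eig show ?thesis
    by simp
next
  case False
  define w where "w = S v - sqrt r *\<^sub>R v"
  have "S w = - (sqrt r *\<^sub>R w)"
    using r by (simp add: w_def linear_diff[OF lin] linear_scale[OF lin] eig
        scaleR_diff_right flip: real_sqrt_mult)
  then have "sqrt r * (w \<bullet> w) \<le> 0"
    using nonneg[of w] by simp
  then have "w \<bullet> w \<le> 0"
    using r False by (simp add: mult_le_0_iff)
  then have "w = 0"
    by (metis inner_gt_zero_iff not_less)
  then show ?thesis
    by (simp add: w_def)
qed

lemma sqrt_op_diagonal:
  fixes e :: "nat \<Rightarrow> 'a::{real_inner, complete_space}"
  assumes e: "complete_orthonormal_basis e" and Q: "bounded_linear Q"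
    and l: "\<And>k. k \<ge> 1 \<Longrightarrow> l k \<ge> 0" and eig: "\<And>k. k \<ge> 1 \<Longrightarrow> Q (e k) = l k *\<^sub>R e k"
    and sm: "summable (\<lambda>k. l (Suc k))"
  shows "bounded_linear (sqrt_op Q)"
    and "sqrt_op Q \<circ> sqrt_op Q = Q"
    and "(\<lambda>N. diag_trunc (\<lambda>k. sqrt (l k)) e N x) \<longlonglongrightarrow> sqrt_op Q x"
proof -
  obtain S where S: "bounded_linear S" "symmetric_op S" "\<And>x. S x \<bullet> x \<ge> 0" "S \<circ> S = Q"
    and lim: "\<And>x. (\<lambda>N. diag_trunc (\<lambda>k. sqrt (l k)) e N x) \<longlonglongrightarrow> S x"
    using diagonal_sqrt[OF e Q l eig sm] by blast
  have basis: "R (e k) = sqrt (l k) *\<^sub>R e k"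
    if "bounded_linear R" "symmetric_op R" "\<And>x. R x \<bullet> x \<ge> 0" "R \<circ> R = Q" "k \<ge> 1" for R k
    using sqrt_eigenvector[OF bounded_linear.linear[OF that(1)] that(2,3)] eig[OF that(5)] l[OF that(5)]
      fun_cong[OF that(4), of "e k"] by simp
  have "sqrt_op Q = S"
    unfolding sqrt_op_def
  proof (rule the_equality)
    fix R assume "bounded_linear R \<and> symmetric_op R \<and> (\<forall>x. 0 \<le> R x \<bullet> x) \<and> R \<circ> R = Q"
    then show "R = S"
      using bounded_linear_eq_on_basis[OF e, of R S] S basis by metis
  qed (use S in blast)
  with S lim show "bounded_linear (sqrt_op Q)" "sqrt_op Q \<circ> sqrt_op Q = Q"
    "(\<lambda>N. diag_trunc (\<lambda>k. sqrt (l k)) e N x) \<longlonglongrightarrow> sqrt_op Q x"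
    by simp_all
qed

section \<open>The spectral tail\<close>

text \<open>A positive null sequence attains its supremum over any tail: once its terms have dropped
  below \<open>l (Suc n)\<close>, they cannot compete.\<close>

lemma lambda_star_upper_attained:
  assumes pos: "\<And>k. k \<ge> 1 \<Longrightarrow> l k > 0" and lim: "(\<lambda>k. l (Suc k)) \<longlonglongrightarrow> 0"
  shows "lambda_star l n \<in> l ` {n<..}" and "k > n \<Longrightarrow> l k \<le> lambda_star l n"
proof -
  have "l \<longlonglongrightarrow> 0"
    using lim by (rule LIMSEQ_imp_Suc)
  moreover have "l (Suc n) > 0"
    by (simp add: pos)
  ultimately obtain K where K: "\<And>k. k \<ge> K \<Longrightarrow> l k < l (Suc n)"
    using order_tendstoD(2) eventually_sequentially by metis
  define m where "m = Max (l ` {n<..n + K + 1})"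
  have le: "l k \<le> m" if "k > n" for k
  proof (cases "k \<le> n + K + 1")
    case True
    with that show ?thesis
      unfolding m_def by (intro Max_ge) auto
  next
    case False
    then have "l k < l (Suc n)"
      by (intro K) simp
    also have "\<dots> \<le> m"
      unfolding m_def by (intro Max_ge) auto
    finally show ?thesis by simp
  qed
  have "m \<in> l ` {n<..n + K + 1}"
    unfolding m_def by (rule Max_in) auto
  then have mem: "m \<in> l ` {n<..}"
    by auto
  have "lambda_star l n = m"
    unfolding lambda_star_def by (rule Greatest_equality) (use mem le in auto)
  with mem le show "lambda_star l n \<in> l ` {n<..}" "k > n \<Longrightarrow> l k \<le> lambda_star l n"
    by auto
qed

lemma lambda_star_pos:
  assumes "\<And>k. k \<ge> 1 \<Longrightarrow> l k > 0" and "(\<lambda>k. l (Suc k)) \<longlonglongrightarrow> 0"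
  shows "lambda_star l n > 0"
  using lambda_star_upper_attained(1)[OF assms, of n] assms(1) by auto

text \<open>Only the terms with \<open>k > n\<close> survive in \<open>\<Sum>k. l k \<langle>y, e k\<rangle>\<^sup>2\<close>; the bound on the partial sums
  then follows from Bessel's inequality.\<close>

lemma norm_diag_tail_le:
  assumes e: "complete_orthonormal_basis e"
    and l: "\<And>k. k \<ge> 1 \<Longrightarrow> l k \<ge> 0" and le: "\<And>k. k > n \<Longrightarrow> l k \<le> b"
    and orth: "\<And>k. 1 \<le> k \<Longrightarrow> k \<le> n \<Longrightarrow> y \<bullet> e k = 0"
    and lim: "(\<lambda>N. diag_trunc (\<lambda>k. sqrt (l k)) e N y) \<longlonglongrightarrow> z"
  shows "norm z \<le> sqrt b * norm y"
proof (rule LIMSEQ_le_const2[OF tendsto_norm[OF lim]], intro exI allI impI)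
  fix N
  have b: "b \<ge> 0"
    using l[of "Suc n"] le[of "Suc n"] by simp
  have "(norm (diag_trunc (\<lambda>k. sqrt (l k)) e N y))\<^sup>2 = (\<Sum>k=1..N. (sqrt (l k) * (y \<bullet> e k))\<^sup>2)"
    unfolding diag_trunc_def by (rule norm_basis_sum[OF e]) auto
  also have "\<dots> \<le> (\<Sum>k=1..N. b * (y \<bullet> e k)\<^sup>2)"
  proof (intro sum_mono)
    fix k assume "k \<in> {1..N}"
    then show "(sqrt (l k) * (y \<bullet> e k))\<^sup>2 \<le> b * (y \<bullet> e k)\<^sup>2"
      using l[of k] le[of k] orth[of k]
      by (cases "k \<le> n") (auto simp: power_mult_distrib intro!: mult_right_mono)
  qed
  also have "\<dots> = b * (norm (proj_trunc e N y))\<^sup>2"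
    by (simp add: norm_proj_trunc[OF e] sum_distrib_left)
  also have "\<dots> \<le> b * (norm y)\<^sup>2"
    using b by (intro mult_left_mono power_mono norm_proj_trunc_le[OF e]) auto
  finally have "sqrt ((norm (diag_trunc (\<lambda>k. sqrt (l k)) e N y))\<^sup>2) \<le> sqrt (b * (norm y)\<^sup>2)"
    by (rule real_sqrt_le_mono)
  then show "norm (diag_trunc (\<lambda>k. sqrt (l k)) e N y) \<le> sqrt b * norm y"
    by (simp add: real_sqrt_mult)
qed

section \<open>The truncation error of minimizers\<close>

theorem theorem3p3:
  fixes Q :: "'a::{real_inner, polish_space} \<Rightarrow> 'a"
    and e :: "nat \<Rightarrow> 'a"
    and l :: "nat \<Rightarrow> real"
    and \<Phi> :: "'a \<Rightarrow> real"
  assumes "infinite_dimensional TYPE('a)"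
    and "symmetric_op Q" and "positive_op Q" and "trace_class Q"
    and "complete_orthonormal_basis e"
    and "\<And>k. k \<ge> 1 \<Longrightarrow> l k \<ge> 0"
    and "\<And>k. k \<ge> 1 \<Longrightarrow> Q (e k) = l k *\<^sub>R e k"
    and "summable (\<lambda>k. l (Suc k))"
    and "locally_lipschitz \<Phi>"
  shows "\<forall>M. M \<subseteq> argmin_set (objective Q \<Phi>) \<and> bounded M \<longrightarrow>
           (\<exists>L>0. \<forall>x\<in>M. \<forall>n\<ge>1.
              norm (x - proj_trunc e n x) < L * sqrt (lambda_star l n))"
proof (intro allI impI, elim conjE)
  fix M assume M: "M \<subseteq> argmin_set (objective Q \<Phi>)" and "bounded M"
  define S where "S = sqrt_op Q"
  note e = assms(5) and l = assms(6) and eig = assms(7) and sm = assms(8)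
  have Q: "bounded_linear Q"
    using assms(4) by (simp add: trace_class_def)
  have bl: "bounded_linear S" and SS: "S \<circ> S = Q"
    and lim: "\<And>x. (\<lambda>N. diag_trunc (\<lambda>k. sqrt (l k)) e N x) \<longlonglongrightarrow> S x"
    unfolding S_def using sqrt_op_diagonal[OF e Q l eig sm] by simp_all
  have lin: "linear S"
    using bl by (rule bounded_linear.linear)
  have inj: "S y \<noteq> 0" if "y \<noteq> 0" for y
  proof
    assume "S y = 0"
    then have "Q y = 0"
      using fun_cong[OF SS, of y] linear_0[OF lin] by simp
    with that assms(3) show False
      unfolding positive_op_def by (metis inner_zero_left less_irrefl)
  qed
  have lpos: "l k > 0" if "k \<ge> 1" for k
  proof -
    have ek: "e k \<bullet> e k = 1"
      using basis_inner[OF e that that] by simp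
    then have "e k \<noteq> 0"
      by auto
    then have "Q (e k) \<bullet> e k > 0"
      using assms(3) by (simp add: positive_op_def)
    then show ?thesis
      by (simp add: eig[OF that] ek)
  qed
  note l0 = summable_LIMSEQ_zero[OF sm]
  obtain B where B: "B > 0" "\<And>x. x \<in> M \<Longrightarrow> norm x \<le> B"
    using \<open>bounded M\<close> bounded_pos by metis
  obtain C where C: "C > 0" "\<And>x. norm (S x) \<le> norm x * C"
    using bounded_linear.pos_bounded[OF bl] by blast
  \<comment> \<open>The Lipschitz condition is stated on open balls, so the radius must exceed \<open>B * C\<close>.\<close>
  have r: "B * C + 1 > 0"
    using B(1) C(1) by (simp add: add_pos_pos)
  have in_ball: "norm (S x) < B * C + 1" if "norm x \<le> B" for x
    using C(2)[of x] mult_right_mono[OF that, of C] C(1) by linarith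
  obtain L where L: "L > 0" and Lip: "\<And>z1 z2. z1 \<noteq> z2 \<Longrightarrow> norm z1 < B * C + 1 \<Longrightarrow>
      norm z2 < B * C + 1 \<Longrightarrow> \<bar>\<Phi> z1 - \<Phi> z2\<bar> < L * norm (z1 - z2)"
    using assms(9) r unfolding locally_lipschitz_def by metis
  have "norm (x - proj_trunc e n x) < L * sqrt (lambda_star l n)" if "x \<in> M" for x n
  proof (cases "x = proj_trunc e n x")
    case True
    then show ?thesis
      using L lambda_star_pos[OF lpos l0, of n] by simp
  next
    case False
    define p where "p = proj_trunc e n x"
    define y where "y = x - p"
    have y: "y \<noteq> 0"
      using False by (simp add: y_def p_def)
    have Sy: "S x - S p = S y"
      by (simp add: y_def linear_diff[OF lin])
    have "objective Q \<Phi> x \<le> objective Q \<Phi> p"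
      using M that by (auto simp: argmin_set_def is_arg_min_linorder)
    then have "(norm y)\<^sup>2 \<le> \<Phi> (S p) - \<Phi> (S x)"
      using proj_trunc_Pythagorean[OF e, of x n] by (simp add: objective_def S_def y_def p_def)
    also have "\<dots> < L * norm (S y)"
    proof -
      have "norm p \<le> B"
        using norm_proj_trunc_le[OF e, of n x] B(2)[OF that] by (simp add: p_def)
      moreover have "S x \<noteq> S p"
        using Sy inj[OF y] by auto
      ultimately have "\<bar>\<Phi> (S x) - \<Phi> (S p)\<bar> < L * norm (S x - S p)"
        using B(2)[OF that] by (intro Lip in_ball)
      then show ?thesis
        by (simp add: Sy)
    qed
    also have "\<dots> \<le> L * (sqrt (lambda_star l n) * norm y)"
    proof (intro mult_left_mono norm_diag_tail_le[OF e l _ _ lim])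
      show "l k \<le> lambda_star l n" if "k > n" for k
        by (rule lambda_star_upper_attained(2)[of l, OF lpos l0 that])
      show "y \<bullet> e k = 0" if "1 \<le> k" "k \<le> n" for k
        using inner_proj_trunc_basis[OF e that] by (simp add: y_def p_def inner_diff_left)
    qed (use L in simp_all)
    finally have "norm y * norm y < (L * sqrt (lambda_star l n)) * norm y"
      by (simp add: power2_eq_square mult.assoc)
    then show ?thesis
      using y by (simp add: y_def p_def mult_less_cancel_right)
  qed
  with L show "\<exists>L>0. \<forall>x\<in>M. \<forall>n\<ge>1. norm (x - proj_trunc e n x) < L * sqrt (lambda_star l n)"
    by blast
qed

end
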